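(* Let $(X,d_X)$ and $(J,d_J)$ be compact metric spaces, let $(X,(\phi_j)_{j\in J})$ be a uniformly contractible iterated function system, let $\nu$ be a Borel probability on $J$ with $\operatorname{supp}(\nu)=J$, and let $A:J\to\mathbb{R}$, $A(j)=A_j$, be a Lipschitz continuous function. For each $\beta>0$ let $$q_j^{\beta}=\frac{e^{\beta A_j}}{\int_J e^{\beta A_i}\,d\nu(i)},\quad j\in J,$$ and let $\rho_{\beta A}$ be the Gibbs probability on $X$, i.e. the unique Borel probability on $X$ satisfying $$\int_X f\,d\rho_{\beta A}=\int_J q_j^{\beta}\left(\int_X f\circ\phi_j\,d\rho_{\beta A}\right)d\nu(j)\quad\text{for all } f\in C(X,\mathbb{R}).$$ Let $q_j=A_j-\max_{i\in J}A_i$ for $j\in J$. Then the family $(\rho_{\beta A})_{\beta>0}$ satisfies a large deviation principle (as $\beta\to+\infty$), and its rate function is given by $$I(x)=-\sup_{(j_1,j_2,j_3,\ldots)\in\pi^{-1}(x)}\left[q_{j_1}+q_{j_2}+q_{j_3}+\cdots\right],\quad x\in X,$$ where $\pi:J^{\mathbb{N}}\to X$ is the map $\pi(j_1,j_2,\ldots)=\lim_{n\to\infty}\phi_{j_1}\circ\cdots\circ\phi_{j_n}(x_0)$, which does not depend on $x_0\in X$.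
   Context: All metric spaces carry their Borel sigma-algebra; $C(X,\mathbb{R})$ is the set of continuous functions $X\to\mathbb{R}$. Uniformly contractible iterated function system: a family of maps $\phi_j:X\to X$, $j\in J$, for which there is $0<\gamma<1$ with $d_X(\phi_{j_1}(x_1),\phi_{j_2}(x_2))\le\gamma\,[d_J(j_1,j_2)+d_X(x_1,x_2)]$ for all $j_1,j_2\in J$, $x_1,x_2\in X$. For any $(j_1,j_2,\ldots)\in J^{\mathbb{N}}$ the limit defining $\pi(j_1,j_2,\ldots)$ exists and is independent of $x_0$. Since all $q_j\le 0$, each series $q_{j_1}+q_{j_2}+\cdots$ has a value in $[-\infty,0]$. The supremum over the empty set is $-\infty$ (so $I(x)=+\infty$ if $\pi^{-1}(x)=\emptyset$). Large deviation principle: a family $(\mu_\beta)_{\beta>0}$ of probabilities on $X$ satisfies a large deviation principle with rate (deviation) function $I$ if $I:X\to[0,+\infty]$ is lower semi-continuous and (1) for each closed $C\subset X$, $\limsup_{\beta\to+\infty}\frac1\beta\log\mu_\beta(C)\le-\inf_{C}I$; (2) for each open $U\subset X$, $\liminf_{\beta\to+\infty}\frac1\beta\log\mu_\beta(U)\ge-\inf_{U}I$. Conventions: $\log 0=-\infty$ and $-\inf_{\emptyset}I=-\infty$. *)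

theory Defs
  imports "HOL-Probability.Probability"
begin

definition uniformly_contractible_ifs :: "('j::metric_space \<Rightarrow> 'x::metric_space \<Rightarrow> 'x) \<Rightarrow> bool" where
  "uniformly_contractible_ifs \<phi> \<longleftrightarrow>
     (\<exists>\<gamma>. 0 < \<gamma> \<and> \<gamma> < 1 \<and>
        (\<forall>j1 j2 x1 x2. dist (\<phi> j1 x1) (\<phi> j2 x2) \<le> \<gamma> * (dist j1 j2 + dist x1 x2)))"

definition borel_probability :: "'a::topological_space measure \<Rightarrow> bool" where
  "borel_probability \<mu> \<longleftrightarrow> prob_space \<mu> \<and> sets \<mu> = sets borel"

definition measure_supp :: "'a::topological_space measure \<Rightarrow> 'a set" where
  "measure_supp \<mu> = {x. \<forall>U. open U \<and> x \<in> U \<longrightarrow> 0 < emeasure \<mu> U}"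

text \<open>Sequences are indexed from 0, so \<^term>\<open>s 0\<close> plays the role of $j_1$:
  the composition below is $\phi_{j_1} \circ \cdots \circ \phi_{j_n}$, with $\phi_{j_n}$ applied first.\<close>

primrec ifs_comp :: "('j \<Rightarrow> 'x \<Rightarrow> 'x) \<Rightarrow> (nat \<Rightarrow> 'j) \<Rightarrow> nat \<Rightarrow> 'x \<Rightarrow> 'x" where
  "ifs_comp \<phi> s 0 = id"
| "ifs_comp \<phi> s (Suc n) = ifs_comp \<phi> s n \<circ> \<phi> (s n)"

definition coding_map :: "('j \<Rightarrow> 'x::metric_space \<Rightarrow> 'x) \<Rightarrow> (nat \<Rightarrow> 'j) \<Rightarrow> 'x" where
  "coding_map \<phi> s = (THE y. \<forall>x0. (\<lambda>n. ifs_comp \<phi> s n x0) \<longlonglongrightarrow> y)"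

definition gibbs_weight :: "'j measure \<Rightarrow> ('j \<Rightarrow> real) \<Rightarrow> real \<Rightarrow> 'j \<Rightarrow> real" where
  "gibbs_weight \<nu> A \<beta> j = exp (\<beta> * A j) / (\<integral>i. exp (\<beta> * A i) \<partial>\<nu>)"

definition is_gibbs_probability ::
  "'j measure \<Rightarrow> ('j \<Rightarrow> 'x::metric_space \<Rightarrow> 'x) \<Rightarrow> ('j \<Rightarrow> real) \<Rightarrow> real \<Rightarrow> 'x measure \<Rightarrow> bool" where
  "is_gibbs_probability \<nu> \<phi> A \<beta> \<rho> \<longleftrightarrow>
     borel_probability \<rho> \<and>
     (\<forall>f :: 'x \<Rightarrow> real. continuous_on UNIV f \<longrightarrow>
        (\<integral>x. f x \<partial>\<rho>) = (\<integral>j. gibbs_weight \<nu> A \<beta> j * (\<integral>x. f (\<phi> j x) \<partial>\<rho>) \<partial>\<nu>))"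

definition gibbs_probability ::
  "'j measure \<Rightarrow> ('j \<Rightarrow> 'x::metric_space \<Rightarrow> 'x) \<Rightarrow> ('j \<Rightarrow> real) \<Rightarrow> real \<Rightarrow> 'x measure" where
  "gibbs_probability \<nu> \<phi> A \<beta> = (THE \<rho>. is_gibbs_probability \<nu> \<phi> A \<beta> \<rho>)"

text \<open>The maximum of $A$ is written as a supremum: \<^const>\<open>Max\<close> is only meaningful
  on finite sets, and a continuous function on a compact space attains its supremum.\<close>

definition normalized_potential :: "('j \<Rightarrow> real) \<Rightarrow> 'j \<Rightarrow> real" where
  "normalized_potential A j = A j - (SUP i. A i)"

text \<open>The series is taken in \<^typ>\<open>ereal\<close>, where it may sum to $-\infty$;
  the supremum over the empty set is $-\infty$ there.\<close>

definition gibbs_rate :: "('j \<Rightarrow> 'x::metric_space \<Rightarrow> 'x) \<Rightarrow> ('j \<Rightarrow> real) \<Rightarrow> 'x \<Rightarrow> ereal" where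
  "gibbs_rate \<phi> A x =
     - (SUP s \<in> coding_map \<phi> -` {x}. \<Sum>n. ereal (normalized_potential A (s n)))"

definition log_ereal :: "real \<Rightarrow> ereal" where
  "log_ereal p = (if p = 0 then - \<infinity> else ereal (ln p))"

definition lower_semicontinuous :: "('a::topological_space \<Rightarrow> ereal) \<Rightarrow> bool" where
  "lower_semicontinuous I \<longleftrightarrow> (\<forall>x. I x \<le> Liminf (at x) I)"

text \<open>Only the members with positive index matter; infima are taken in \<^typ>\<open>ereal\<close>,
  so the infimum over the empty set is $+\infty$.\<close>

definition large_deviation_principle ::
  "(real \<Rightarrow> 'a::metric_space measure) \<Rightarrow> ('a \<Rightarrow> ereal) \<Rightarrow> bool" where
  "large_deviation_principle \<mu> I \<longleftrightarrow>
     (\<forall>\<beta>>0. borel_probability (\<mu> \<beta>)) \<and>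
     (\<forall>x. 0 \<le> I x) \<and>
     lower_semicontinuous I \<and>
     (\<forall>C. closed C \<longrightarrow>
        Limsup at_top (\<lambda>\<beta>. ereal (1 / \<beta>) * log_ereal (measure (\<mu> \<beta>) C)) \<le> - (INF x\<in>C. I x)) \<and>
     (\<forall>U. open U \<longrightarrow>
        - (INF x\<in>U. I x) \<le> Liminf at_top (\<lambda>\<beta>. ereal (1 / \<beta>) * log_ereal (measure (\<mu> \<beta>) U)))"

end

theory Submission
  imports Defs
begin

text \<open>
  Write \<open>q j \<le> 0\<close> for the normalized potential. Under the probability \<open>w \<nu>\<close> on the letters, with \<open>w\<close> the Gibbs
  weight at \<open>\<beta>\<close>, an infinite sequence of independent letters has a law on the code space, and the Gibbs
  probability is the image of this law under the coding map: prefixing a letter \<open>j\<close> to a code corresponds to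
  applying \<open>\<phi> j\<close> to the coded point (\<open>coding_map_case_nat\<close>, \<open>is_gibbs_code_image\<close>). It is the only solution of
  the Gibbs equation because this equation contracts the Lipschitz constants of test functions
  (\<open>gibbs_discrepancy\<close>).

  The large deviation principle is therefore a statement about independent letters. On the scale \<open>1 / \<beta>\<close>
  the weight of a letter \<open>j\<close> is \<open>exp (\<beta> * q j)\<close>: it is at least that (\<open>gibbs_weight_lower\<close>), and at most that
  times \<open>exp (\<beta> * \<epsilon>) / p\<close> with a constant \<open>p > 0\<close> depending only on \<open>\<epsilon>\<close> (\<open>gibbs_weight_upper\<close>). Hence a cylinder of
  length \<open>n\<close> around a code \<open>s\<close> costs about minus the sum of \<open>q\<close> over the first \<open>n\<close> letters of \<open>s\<close>.

  For an open set this gives the lower bound at once, since the coding map is continuous and an open set of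
  codes contains a cylinder around each of its elements. For a closed set \<open>C\<close>, infinitely many letters matter and
  the upper bounds on the weights cannot be multiplied over all of them. Compactness of the space of codes
  resolves this. If the total sum of \<open>q\<close> is below \<open>c\<close> along every code of a point of \<open>C\<close>, then already the sum over
  the first \<open>n\<close> letters is below \<open>c\<close> for all these codes, with one \<open>n\<close> (\<open>code_sum_uniform_on_compact\<close>), and for
  fixed \<open>n\<close> an exponential Markov inequality bounds the probability of this event (\<open>code_sum_tail_bound\<close>). The
  same compactness argument, applied to a single fibre of the coding map, shows that the rate is lower
  semicontinuous.
\<close>

section \<open>Borel sets of compact metric spaces\<close>

text \<open>
  The type class of metric spaces does not include second countability, and without it the Borel sets
  of a product may exceed the product of the Borel \<open>\<sigma>\<close>-algebras. Compactness repairs this: the balls of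
  radius \<open>1 / (n + 1)\<close> around finite nets, for all \<open>n\<close>, form a countable basis.
\<close>
lemma compact_UNIV_countable_basis:
  assumes "compact (UNIV :: 'a::metric_space set)"
  obtains B :: "'a::metric_space set set" where "countable B" "topological_basis B"
proof -
  have "\<exists>k::'a set. finite k \<and> UNIV = (\<Union>x\<in>k. ball x (1 / real (Suc n)))" for n
  proof -
    have "\<exists>k::'a set. finite k \<and> UNIV \<subseteq> (\<Union>x\<in>k. ball x (1 / real (Suc n)))"
      using assms unfolding compact_eq_totally_bounded by (meson divide_pos_pos of_nat_0_less_iff zero_less_Suc zero_less_one)
    then show ?thesis by blast
  qed
  then obtain k :: "nat \<Rightarrow> 'a set" where k: "\<And>n. finite (k n)"
    "\<And>n. UNIV = (\<Union>x\<in>k n. ball x (1 / real (Suc n)))"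
    by metis
  define B where "B = (\<Union>n. (\<lambda>x. ball x (1 / real (Suc n))) ` k n)"
  have "countable B"
    using k(1) unfolding B_def by (intro countable_UN) (auto intro: countable_finite)
  moreover have "topological_basis B"
  proof (rule topological_basisI)
    fix U :: "'a set" and x assume "open U" "x \<in> U"
    then obtain e where e: "e > 0" "ball x e \<subseteq> U" by (meson openE)
    obtain n where n: "1 / real (Suc n) < e / 2"
      using e by (metis half_gt_zero nat_approx_posE)
    obtain y where y: "y \<in> k n" "x \<in> ball y (1 / real (Suc n))"
      using k(2)[of n] by blast
    have "ball y (1 / real (Suc n)) \<subseteq> ball x e"
    proof
      fix z assume "z \<in> ball y (1 / real (Suc n))"
      then have "dist x z < 1 / real (Suc n) + 1 / real (Suc n)"
        using y(2) dist_triangle[of x z y] by (simp add: dist_commute)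
      then show "z \<in> ball x e" using n by simp
    qed
    then show "\<exists>B'\<in>B. x \<in> B' \<and> B' \<subseteq> U"
      using e y unfolding B_def by blast
  qed (auto simp: B_def)
  ultimately show ?thesis using that by blast
qed

lemma continuous_pair_measurable:
  fixes f :: "'a::metric_space \<times> 'b::metric_space \<Rightarrow> 'c::topological_space"
  assumes "compact (UNIV :: 'a set)" "compact (UNIV :: 'b set)" "continuous_on UNIV f"
  shows "f \<in> borel_measurable (borel \<Otimes>\<^sub>M borel)"
proof (rule borel_measurableI)
  fix S :: "'c set" assume "open S"
  then have op: "open (f -` S)" using assms(3) by (simp add: open_vimage)
  obtain A :: "'a set set" where A: "countable A" "topological_basis A"
    using compact_UNIV_countable_basis[OF assms(1)] by blast
  obtain B :: "'b set set" where B: "countable B" "topological_basis B"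
    using compact_UNIV_countable_basis[OF assms(2)] by blast
  have "\<exists>R\<subseteq>(\<lambda>(a, b). a \<times> b) ` (A \<times> B). \<Union>R = f -` S"
    using topological_basis_prod[OF A(2) B(2)] op by (simp add: topological_basis_def)
  then obtain R where R: "R \<subseteq> (\<lambda>(a, b). a \<times> b) ` (A \<times> B)" "\<Union>R = f -` S"
    by (elim exE conjE)
  have "countable R"
    using R(1) A(1) B(1) by (meson countable_SIGMA countable_image countable_subset)
  moreover have "r \<in> sets (borel \<Otimes>\<^sub>M borel)" if r: "r \<in> R" for r
  proof -
    obtain a b where ab: "r = a \<times> b" "a \<in> A" "b \<in> B" 
      using subsetD[OF R(1) r] by auto
    then have "open a" "open b"
      using A B topological_basis_open by blast+
    then show ?thesis using ab(1) by simp
  qed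
  ultimately have "\<Union>R \<in> sets (borel \<Otimes>\<^sub>M borel)"
    by (intro sets.countable_Union) auto
  then show "f -` S \<inter> space (borel \<Otimes>\<^sub>M borel) \<in> sets (borel \<Otimes>\<^sub>M borel)"
    using R(2) by (simp add: space_pair_measure)
qed

text \<open>
  Lipschitz test functions suffice because \<open>max 0 (1 - n * infdist x C)\<close> is Lipschitz and converges
  boundedly to the indicator of a closed set \<open>C\<close>, and the closed sets form an intersection-stable
  generator of the Borel sets.
\<close>
lemma measure_eqI_lipschitz:
  fixes \<mu> \<nu> :: "'a::metric_space measure"
  assumes "borel_probability \<mu>" "borel_probability \<nu>"
    and eq: "\<And>L f. L-lipschitz_on UNIV f \<Longrightarrow> (\<integral>x. f x \<partial>\<mu>) = (\<integral>x. (f x::real) \<partial>\<nu>)"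
  shows "\<mu> = \<nu>"
proof -
  interpret \<mu>: prob_space \<mu> using assms(1) by (simp add: borel_probability_def)
  interpret \<nu>: prob_space \<nu> using assms(2) by (simp add: borel_probability_def)
  have sets: "sets \<mu> = sets borel" "sets \<nu> = sets borel"
    using assms by (simp_all add: borel_probability_def)
  have closed_eq: "measure \<mu> C = measure \<nu> C" if C: "closed C" "C \<noteq> {}" for C
  proof -
    define f where "f n x = max 0 (1 - real n * infdist x C)" for n x
    have lip: "(real n)-lipschitz_on UNIV (f n)" for n
    proof (rule lipschitz_onI)
      fix x y :: 'a
      have "\<bar>real n * infdist x C - real n * infdist y C\<bar> \<le> real n * dist x y"
        using mult_left_mono[OF infdist_triangle_abs[of x C y], of "real n"]
        by (simp add: abs_mult flip: right_diff_distrib)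
      then show "dist (f n x) (f n y) \<le> real n * dist x y"
        unfolding f_def dist_real_def by linarith
    qed simp
    have meas: "f n \<in> borel_measurable borel" for n
      by (rule borel_measurable_continuous_onI) (rule lipschitz_on_continuous_on[OF lip])
    have lim: "(\<lambda>n. f n x) \<longlonglongrightarrow> indicat_real C x" for x
    proof (cases "x \<in> C")
      case True then show ?thesis by (simp add: f_def)
    next
      case False
      then have pos: "infdist x C > 0"
        using C in_closed_iff_infdist_zero infdist_nonneg[of x C] by fastforce
      obtain m where m: "real m * infdist x C > 1" using reals_Archimedean3[OF pos] by blast
      have "f n x = 0" if "n \<ge> m" for n
      proof -
        have "real n * infdist x C \<ge> real m * infdist x C"
          using that pos by (intro mult_right_mono) auto
        then show ?thesis using m by (simp add: f_def)
      qed
      then have "eventually (\<lambda>n. f n x = 0) sequentially"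
        using eventually_sequentially by blast
      then show ?thesis using False by (simp add: tendsto_eventually)
    qed
    have bd: "norm (f n x) \<le> 1" for n x
      using infdist_nonneg[of x C] by (simp add: f_def)
    have conv: "(\<lambda>n. \<integral>x. f n x \<partial>M) \<longlonglongrightarrow> (\<integral>x. indicat_real C x \<partial>M)"
      if "prob_space M" "sets M = sets borel" for M :: "'a measure"
    proof -
      interpret prob_space M by fact
      note [measurable_cong] = that(2)
      note [measurable] = meas borel_closed[OF C(1)]
      show ?thesis
        by (rule integral_dominated_convergence[where w="\<lambda>_. 1"]) (use lim bd in auto)
    qed
    have "(\<integral>x. indicat_real C x \<partial>\<mu>) = (\<integral>x. indicat_real C x \<partial>\<nu>)"
      using conv[OF \<mu>.prob_space_axioms sets(1)] conv[OF \<nu>.prob_space_axioms sets(2)] eq[OF lip]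
      by (simp add: LIMSEQ_unique)
    then show ?thesis using C sets by simp
  qed
  have closed_eq': "emeasure \<mu> C = emeasure \<nu> C" if "closed C" for C
    using closed_eq[OF that] by (cases "C = {}") (auto simp: \<mu>.emeasure_eq_measure \<nu>.emeasure_eq_measure)
  show ?thesis
  proof (rule measure_eqI_generator_eq[where E="Collect closed" and \<Omega>=UNIV and A="\<lambda>_. UNIV"])
    show "Int_stable (Collect closed :: 'a set set)" by (auto simp: Int_stable_def)
    show "sets \<mu> = sigma_sets UNIV (Collect closed)"
      by (simp add: sets borel_eq_closed)
    show "sets \<nu> = sigma_sets UNIV (Collect closed)"
      by (simp add: sets borel_eq_closed)
  qed (use closed_eq' in auto)
qed

lemma compact_UNIV_fun:
  assumes "compact (UNIV :: 'j::topological_space set)"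
  shows "compact (UNIV :: ('i \<Rightarrow> 'j) set)"
proof -
  have "compact_space (product_topology (\<lambda>_::'i. euclidean :: 'j topology) UNIV)"
    unfolding compact_space_product_topology using assms by (simp add: compact_space_def)
  then show ?thesis
    by (simp add: euclidean_product_topology compact_space_def)
qed

section \<open>The coding map\<close>

locale compact_ifs =
  fixes \<phi> :: "'j::metric_space \<Rightarrow> 'x::metric_space \<Rightarrow> 'x" and \<gamma> :: real
  assumes compact_space: "compact (UNIV :: 'x set)"
    and compact_index: "compact (UNIV :: 'j set)"
    and \<gamma>: "0 < \<gamma>" "\<gamma> < 1"
    and contract: "dist (\<phi> i x) (\<phi> j y) \<le> \<gamma> * (dist i j + dist x y)"
begin

lemma continuous_phi: "continuous_on UNIV (\<lambda>p. \<phi> (fst p) (snd p))"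
proof -
  have "dist (\<phi> (fst p) (snd p)) (\<phi> (fst q) (snd q)) \<le> 2 * dist p q" for p q
  proof -
    have "dist (\<phi> (fst p) (snd p)) (\<phi> (fst q) (snd q)) \<le> \<gamma> * (dist (fst p) (fst q) + dist (snd p) (snd q))"
      by (rule contract)
    also have "\<dots> \<le> 1 * (dist (fst p) (fst q) + dist (snd p) (snd q))"
      using \<gamma> by (intro mult_right_mono) auto
    also have "\<dots> \<le> 2 * dist p q" using dist_fst_le[of p q] dist_snd_le[of p q] by simp
    finally show ?thesis .
  qed
  then have "2-lipschitz_on UNIV (\<lambda>p. \<phi> (fst p) (snd p))"
    by (intro lipschitz_onI) auto
  then show ?thesis by (rule lipschitz_on_continuous_on)
qed

lemma continuous_on_phi:
  assumes "continuous_on S f" "continuous_on S g"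
  shows "continuous_on S (\<lambda>s. \<phi> (f s) (g s))"
proof -
  have "continuous_on S ((\<lambda>p. \<phi> (fst p) (snd p)) \<circ> (\<lambda>s. (f s, g s)))"
    by (rule continuous_on_compose[OF continuous_on_Pair[OF assms]])
       (rule continuous_on_subset[OF continuous_phi subset_UNIV])
  then show ?thesis by (simp add: o_def)
qed

lemma measurable_phi[measurable]: "(\<lambda>p. \<phi> (fst p) (snd p)) \<in> borel_measurable (borel \<Otimes>\<^sub>M borel)"
  by (rule continuous_pair_measurable[OF compact_index compact_space continuous_phi])

lemma dist_le_diameter: "dist x y \<le> diameter (UNIV :: 'x set)" for x y :: 'x
  by (rule diameter_bounded_bound[OF compact_imp_bounded[OF compact_space]]) simp_all

lemma dist_ifs_comp: "dist (ifs_comp \<phi> s n x) (ifs_comp \<phi> s n y) \<le> \<gamma> ^ n * dist x y"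
proof (induction n arbitrary: x y)
  case (Suc n)
  have "dist (ifs_comp \<phi> s (Suc n) x) (ifs_comp \<phi> s (Suc n) y) \<le> \<gamma> ^ n * dist (\<phi> (s n) x) (\<phi> (s n) y)"
    using Suc by simp
  also have "\<dots> \<le> \<gamma> ^ n * (\<gamma> * dist x y)"
    using contract[of "s n" x "s n" y] \<gamma> by (intro mult_left_mono) auto
  finally show ?case by (simp add: mult_ac)
qed simp

lemma ifs_comp_add: "ifs_comp \<phi> s (n + m) x = ifs_comp \<phi> s n (ifs_comp \<phi> (\<lambda>k. s (n + k)) m x)"
  by (induction m arbitrary: x) auto

text \<open>
  Extending a word from length \<open>n\<close> only changes the point to which its first \<open>n\<close> maps are applied,
  so words that share their first \<open>n\<close> letters stay within \<open>\<gamma> ^ n\<close> times the diameter. This gives both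
  the existence of the limit and its uniformity in the code.
\<close>
lemma dist_ifs_comp_add: "dist (ifs_comp \<phi> s (n + m) x) (ifs_comp \<phi> s n y) \<le> \<gamma> ^ n * diameter (UNIV :: 'x set)"
proof -
  have "dist (ifs_comp \<phi> s (n + m) x) (ifs_comp \<phi> s n y)
      \<le> \<gamma> ^ n * dist (ifs_comp \<phi> (\<lambda>k. s (n + k)) m x) y"
    unfolding ifs_comp_add by (rule dist_ifs_comp)
  also have "\<dots> \<le> \<gamma> ^ n * diameter (UNIV :: 'x set)"
    using \<gamma> by (intro mult_left_mono dist_le_diameter) auto
  finally show ?thesis .
qed

lemma gamma_power_tendsto: "(\<lambda>n. \<gamma> ^ n * c) \<longlonglongrightarrow> 0"
  using \<gamma> by (intro tendsto_mult_left_zero LIMSEQ_power_zero) auto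

lemma ifs_comp_convergent: "\<exists>y. \<forall>x. (\<lambda>n. ifs_comp \<phi> s n x) \<longlonglongrightarrow> y"
proof -
  fix x0 :: 'x
  have "Cauchy (\<lambda>n. ifs_comp \<phi> s n x0)"
  proof (rule metric_CauchyI)
    fix e :: real assume "e > 0"
    then have "eventually (\<lambda>n. \<gamma> ^ n * diameter (UNIV :: 'x set) < e / 2) sequentially"
      by (intro order_tendstoD(2)[OF gamma_power_tendsto]) simp
    then obtain M where M: "\<gamma> ^ M * diameter (UNIV :: 'x set) < e / 2"
      by (auto simp: eventually_sequentially)
    have near: "dist (ifs_comp \<phi> s n x0) (ifs_comp \<phi> s M x0) < e / 2" if "n \<ge> M" for n
      using dist_ifs_comp_add[of s M "n - M" x0 x0] M that by simp
    show "\<exists>M. \<forall>m\<ge>M. \<forall>n\<ge>M. dist (ifs_comp \<phi> s m x0) (ifs_comp \<phi> s n x0) < e"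
      by (intro exI[of _ M] allI impI dist_triangle_half_l[OF near near])
  qed
  then obtain y where y: "(\<lambda>n. ifs_comp \<phi> s n x0) \<longlonglongrightarrow> y"
    using compact_imp_complete[OF compact_space] unfolding complete_def by auto
  have "(\<lambda>n. ifs_comp \<phi> s n x) \<longlonglongrightarrow> y" for x
  proof -
    have bound: "dist (ifs_comp \<phi> s n x) y \<le> \<gamma> ^ n * dist x x0 + dist (ifs_comp \<phi> s n x0) y" for n
      using dist_ifs_comp[of s n x x0] dist_triangle[of "ifs_comp \<phi> s n x" y "ifs_comp \<phi> s n x0"]
      by linarith
    have "(\<lambda>n. \<gamma> ^ n * dist x x0 + dist (ifs_comp \<phi> s n x0) y) \<longlonglongrightarrow> 0"
      using tendsto_add[OF gamma_power_tendsto[of "dist x x0"] y[THEN tendsto_dist_iff[THEN iffD1]]]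
      by simp
    then have "(\<lambda>n. dist (ifs_comp \<phi> s n x) y) \<longlonglongrightarrow> 0"
      by (rule tendsto_sandwich[OF always_eventually always_eventually tendsto_const, rotated -1])
         (use bound in auto)
    then show ?thesis by (subst tendsto_dist_iff)
  qed
  then show ?thesis by blast
qed

lemma coding_map_limit: "(\<lambda>n. ifs_comp \<phi> s n x) \<longlonglongrightarrow> coding_map \<phi> s"
proof -
  obtain y where y: "\<forall>x. (\<lambda>n. ifs_comp \<phi> s n x) \<longlonglongrightarrow> y" using ifs_comp_convergent by blast
  then have "coding_map \<phi> s = y"
    unfolding coding_map_def by (intro the_equality) (auto intro: LIMSEQ_unique)
  then show ?thesis using y by simp
qed

lemma dist_ifs_comp_coding_map: "dist (ifs_comp \<phi> s n x) (coding_map \<phi> s) \<le> \<gamma> ^ n * diameter (UNIV :: 'x set)"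
proof (rule tendsto_upperbound)
  show "((\<lambda>m. dist (ifs_comp \<phi> s n x) (ifs_comp \<phi> s (m + n) x)) \<longlongrightarrow> dist (ifs_comp \<phi> s n x) (coding_map \<phi> s)) sequentially"
    by (intro tendsto_intros LIMSEQ_ignore_initial_segment coding_map_limit)
  show "eventually (\<lambda>m. dist (ifs_comp \<phi> s n x) (ifs_comp \<phi> s (m + n) x) \<le> \<gamma> ^ n * diameter (UNIV :: 'x set)) sequentially"
    using dist_ifs_comp_add[of s n _ x x] by (simp add: dist_commute add.commute)
qed simp

text \<open>
  The self-similarity of the coding map: prefixing a code by \<open>j\<close> applies \<open>\<phi> j\<close>. It turns the shift
  invariance of product measures into the Gibbs equation.
\<close>
lemma coding_map_case_nat: "coding_map \<phi> (case_nat j s) = \<phi> j (coding_map \<phi> s)"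
proof (rule LIMSEQ_unique)
  fix x
  have "ifs_comp \<phi> (case_nat j s) (Suc n) x = \<phi> j (ifs_comp \<phi> s n x)" for n
    using ifs_comp_add[of "case_nat j s" 1 n x] by simp
  then show "(\<lambda>n. \<phi> j (ifs_comp \<phi> s n x)) \<longlonglongrightarrow> coding_map \<phi> (case_nat j s)"
    using LIMSEQ_Suc[OF coding_map_limit[of "case_nat j s" x]] by simp
  have "isCont (\<phi> j) y" for y
    using continuous_on_phi[of UNIV "\<lambda>_. j" "\<lambda>y. y"] by (simp add: continuous_on_eq_continuous_at)
  then show "(\<lambda>n. \<phi> j (ifs_comp \<phi> s n x)) \<longlonglongrightarrow> \<phi> j (coding_map \<phi> s)"
    by (rule isCont_tendsto_compose) (rule coding_map_limit)
qed

lemma continuous_ifs_comp: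
  "continuous_on UNIV g \<Longrightarrow> continuous_on UNIV (\<lambda>s. ifs_comp \<phi> s n (g s))"
proof (induction n arbitrary: g)
  case (Suc n)
  have "continuous_on UNIV (\<lambda>s. \<phi> (s n) (g s))"
    by (intro continuous_on_phi continuous_on_product_coordinates Suc.prems)
  from Suc.IH[OF this] show ?case by simp
qed simp

lemma continuous_coding_map: "continuous_on UNIV (coding_map \<phi>)"
proof (rule uniform_limit_theorem)
  fix x
  show "eventually (\<lambda>n. continuous_on UNIV (\<lambda>s. ifs_comp \<phi> s n x)) sequentially"
    by (simp add: continuous_ifs_comp)
  show "uniform_limit UNIV (\<lambda>n s. ifs_comp \<phi> s n x) (coding_map \<phi>) sequentially"
  proof (rule uniform_limitI)
    fix e :: real assume "e > 0"
    then have "eventually (\<lambda>n. \<gamma> ^ n * diameter (UNIV :: 'x set) < e) sequentially"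
      by (rule order_tendstoD(2)[OF gamma_power_tendsto])
    then show "eventually (\<lambda>n. \<forall>s\<in>UNIV. dist (ifs_comp \<phi> s n x) (coding_map \<phi> s) < e) sequentially"
      by eventually_elim (auto intro: le_less_trans[OF dist_ifs_comp_coding_map])
  qed
qed simp

lemma measurable_ifs_comp:
  "g \<in> borel_measurable (Pi\<^sub>M UNIV (\<lambda>_::nat. borel)) \<Longrightarrow>
   (\<lambda>s. ifs_comp \<phi> s n (g s)) \<in> borel_measurable (Pi\<^sub>M UNIV (\<lambda>_::nat. borel))"
proof (induction n arbitrary: g)
  case (Suc n)
  note [measurable] = Suc.prems
  have "(\<lambda>s. (s n, g s)) \<in> (Pi\<^sub>M UNIV (\<lambda>_::nat. borel)) \<rightarrow>\<^sub>M borel \<Otimes>\<^sub>M borel"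
    by measurable
  from measurable_compose[OF this measurable_phi]
  have "(\<lambda>s. \<phi> (s n) (g s)) \<in> borel_measurable (Pi\<^sub>M UNIV (\<lambda>_::nat. borel))" by simp
  from Suc.IH[OF this] show ?case by simp
qed simp

lemma measurable_coding_map: "coding_map \<phi> \<in> borel_measurable (Pi\<^sub>M UNIV (\<lambda>_::nat. borel))"
proof (rule borel_measurable_LIMSEQ_metric)
  fix x s
  show "(\<lambda>s. ifs_comp \<phi> s n x) \<in> borel_measurable (Pi\<^sub>M UNIV (\<lambda>_::nat. borel))" for n
    by (rule measurable_ifs_comp) simp
  show "(\<lambda>n. ifs_comp \<phi> s n x) \<longlonglongrightarrow> coding_map \<phi> s"
    by (rule coding_map_limit)
qed

end

section \<open>Existence and uniqueness of the Gibbs probability\<close>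

lemma integrable_continuous_compact:
  fixes f :: "'a::metric_space \<Rightarrow> real"
  assumes "compact (UNIV :: 'a set)" "borel_probability M" "continuous_on UNIV f"
  shows "integrable M f"
proof -
  interpret prob_space M using assms(2) by (simp add: borel_probability_def)
  have sets: "sets M = sets borel" using assms(2) by (simp add: borel_probability_def)
  have "f \<in> borel_measurable borel"
    by (rule borel_measurable_continuous_onI[OF assms(3)])
  then have "f \<in> borel_measurable M" by (simp cong: measurable_cong_sets add: sets)
  moreover obtain B where "\<And>x. norm (f x) \<le> B"
    using compact_imp_bounded[OF compact_continuous_image[OF assms(3,1)]]
    unfolding bounded_iff by auto
  ultimately show ?thesis by (intro integrable_const_bound[where B=B]) auto
qed

lemma abs_integral_diff_le:
  fixes f g :: "'a \<Rightarrow> real"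
  assumes "integrable M f" "integrable M g" "integrable M h"
    and "\<And>x. \<bar>f x - g x\<bar> \<le> h x"
  shows "\<bar>(\<integral>x. f x \<partial>M) - (\<integral>x. g x \<partial>M)\<bar> \<le> (\<integral>x. h x \<partial>M)"
proof -
  have "\<bar>(\<integral>x. f x \<partial>M) - (\<integral>x. g x \<partial>M)\<bar> = \<bar>\<integral>x. f x - g x \<partial>M\<bar>"
    using assms by simp
  also have "\<dots> \<le> (\<integral>x. \<bar>f x - g x\<bar> \<partial>M)" by (rule integral_abs_bound)
  also have "\<dots> \<le> (\<integral>x. h x \<partial>M)"
    using assms by (intro integral_mono) auto
  finally show ?thesis .
qed

locale gibbs_ifs = compact_ifs \<phi> \<gamma>
  for \<phi> :: "'j::metric_space \<Rightarrow> 'x::metric_space \<Rightarrow> 'x" and \<gamma> +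
  fixes \<nu> :: "'j measure" and A :: "'j \<Rightarrow> real"
  assumes borel_nu: "borel_probability \<nu>"
    and full_support: "measure_supp \<nu> = UNIV"
    and continuous_A: "continuous_on UNIV A"
begin

sublocale \<nu>: prob_space \<nu>
  using borel_nu by (simp add: borel_probability_def)

lemma sets_nu[measurable_cong]: "sets \<nu> = sets borel"
  using borel_nu by (simp add: borel_probability_def)

lemma partition_pos: "0 < (\<integral>i. exp (\<beta> * A i) \<partial>\<nu>)"
proof -
  have int: "integrable \<nu> (\<lambda>i. exp (\<beta> * A i))"
    by (intro integrable_continuous_compact[OF compact_index borel_nu] continuous_intros continuous_A)
  have "(\<integral>i. exp (\<beta> * A i) \<partial>\<nu>) \<noteq> 0"
    using integral_nonneg_eq_0_iff_AE[OF int] \<nu>.AE_False by simp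
  moreover have "0 \<le> (\<integral>i. exp (\<beta> * A i) \<partial>\<nu>)" by simp
  ultimately show ?thesis by linarith
qed

lemma gibbs_weight_pos: "0 < gibbs_weight \<nu> A \<beta> j"
  unfolding gibbs_weight_def using partition_pos by simp

lemma continuous_gibbs_weight: "continuous_on UNIV (gibbs_weight \<nu> A \<beta>)"
  unfolding gibbs_weight_def using partition_pos[of \<beta>]
  by (intro continuous_intros continuous_A) auto

lemma measurable_gibbs_weight[measurable]: "gibbs_weight \<nu> A \<beta> \<in> borel_measurable borel"
  by (rule borel_measurable_continuous_onI[OF continuous_gibbs_weight])

lemma integral_gibbs_weight: "(\<integral>j. gibbs_weight \<nu> A \<beta> j \<partial>\<nu>) = 1"
  unfolding gibbs_weight_def using partition_pos[of \<beta>] by simp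

lemma integrable_weight_times:
  "continuous_on UNIV g \<Longrightarrow> integrable \<nu> (\<lambda>j. gibbs_weight \<nu> A \<beta> j * g j)"
  by (intro integrable_continuous_compact[OF compact_index borel_nu] continuous_intros continuous_gibbs_weight)

text \<open>
  The Gibbs weights reweight \<open>\<nu>\<close> to a probability on letters. The Gibbs probability turns out to be the
  law of the point coded by a sequence of independent letters with this distribution.
\<close>
definition step_law :: "real \<Rightarrow> 'j measure" where
  "step_law \<beta> = density \<nu> (\<lambda>j. ennreal (gibbs_weight \<nu> A \<beta> j))"

lemma sets_step_law[measurable_cong, simp]: "sets (step_law \<beta>) = sets borel"
  by (simp add: step_law_def sets_nu)

lemma space_step_law[simp]: "space (step_law \<beta>) = UNIV"
  using sets_eq_imp_space_eq[OF sets_step_law] by simp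

lemma nn_integral_step_law:
  "f \<in> borel_measurable borel \<Longrightarrow>
   (\<integral>\<^sup>+j. f j \<partial>step_law \<beta>) = (\<integral>\<^sup>+j. ennreal (gibbs_weight \<nu> A \<beta> j) * f j \<partial>\<nu>)"
  unfolding step_law_def by (rule nn_integral_density) measurable

lemma integral_step_law:
  fixes f :: "'j \<Rightarrow> real"
  shows "f \<in> borel_measurable borel \<Longrightarrow>
   (\<integral>j. f j \<partial>step_law \<beta>) = (\<integral>j. gibbs_weight \<nu> A \<beta> j * f j \<partial>\<nu>)"
  unfolding step_law_def using gibbs_weight_pos[of \<beta>]
  by (subst integral_density) (auto intro: less_imp_le)

lemma prob_space_step_law: "prob_space (step_law \<beta>)"
proof (rule prob_spaceI)
  have "emeasure (step_law \<beta>) (space (step_law \<beta>)) = (\<integral>\<^sup>+j. 1 \<partial>step_law \<beta>)"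
    by simp
  also have "\<dots> = (\<integral>\<^sup>+j. ennreal (gibbs_weight \<nu> A \<beta> j) \<partial>\<nu>)"
    by (subst nn_integral_step_law) simp_all
  also have "\<dots> = ennreal (\<integral>j. gibbs_weight \<nu> A \<beta> j \<partial>\<nu>)"
    using gibbs_weight_pos[of \<beta>]
    by (intro nn_integral_eq_integral integrable_continuous_compact[OF compact_index borel_nu] continuous_gibbs_weight)
       (auto intro: less_imp_le)
  finally show "emeasure (step_law \<beta>) (space (step_law \<beta>)) = 1"
    by (simp add: integral_gibbs_weight)
qed

definition code_law :: "real \<Rightarrow> (nat \<Rightarrow> 'j) measure" where
  "code_law \<beta> = Pi\<^sub>M UNIV (\<lambda>_. step_law \<beta>)"

lemma sequence_space_step_law: "sequence_space (step_law \<beta>)"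
proof -
  interpret prob_space "step_law \<beta>" by (rule prob_space_step_law)
  show ?thesis by unfold_locales
qed

lemma prob_space_code_law: "prob_space (code_law \<beta>)"
  unfolding code_law_def by (rule prob_space_PiM) (rule prob_space_step_law)

lemma sets_code_law[measurable_cong]: "sets (code_law \<beta>) = sets (Pi\<^sub>M UNIV (\<lambda>_::nat. borel))"
  unfolding code_law_def by (rule sets_PiM_cong) simp_all

lemma space_code_law[simp]: "space (code_law \<beta>) = UNIV"
  using sets_eq_imp_space_eq[OF sets_code_law] by (simp add: space_PiM)

lemma measurable_coding_map'[measurable]: "coding_map \<phi> \<in> borel_measurable (code_law \<beta>)"
  using measurable_coding_map by (simp add: measurable_cong_sets[OF sets_code_law refl])

lemma code_law_case_nat:
  "distr (step_law \<beta> \<Otimes>\<^sub>M code_law \<beta>) (code_law \<beta>) (\<lambda>p. case_nat (fst p) (snd p)) = code_law \<beta>"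
  using sequence_space.PiM_iter[OF sequence_space_step_law[of \<beta>]]
  unfolding code_law_def by (simp add: case_prod_unfold)

lemma measurable_case_nat_code_law[measurable]:
  "(\<lambda>p. case_nat (fst p) (snd p)) \<in> step_law \<beta> \<Otimes>\<^sub>M code_law \<beta> \<rightarrow>\<^sub>M code_law \<beta>"
  unfolding code_law_def by measurable

definition code_image :: "real \<Rightarrow> 'x measure" where
  "code_image \<beta> = distr (code_law \<beta>) borel (coding_map \<phi>)"

lemma borel_probability_code_image: "borel_probability (code_image \<beta>)"
  unfolding borel_probability_def code_image_def
  by (simp add: prob_space.prob_space_distr[OF prob_space_code_law])

text \<open>
  Splitting off the first letter of an independent sequence leaves an independent sequence with the same
  law, and prefixing a letter \<open>j\<close> acts on the coded point as \<open>\<phi> j\<close>. Integrating over the first letter by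
  Fubini is exactly the Gibbs equation.
\<close>
lemma is_gibbs_code_image: "is_gibbs_probability \<nu> \<phi> A \<beta> (code_image \<beta>)"
  unfolding is_gibbs_probability_def
proof (intro conjI allI impI borel_probability_code_image)
  fix f :: "'x \<Rightarrow> real" assume f: "continuous_on UNIV f"
  let ?N = "step_law \<beta>" and ?P = "code_law \<beta>"
  have [measurable]: "f \<in> borel_measurable borel" by (rule borel_measurable_continuous_onI[OF f])
  interpret N: prob_space ?N by (rule prob_space_step_law)
  interpret P: prob_space ?P by (rule prob_space_code_law)
  interpret NP: pair_prob_space ?N ?P by unfold_locales
  have [measurable]: "(\<lambda>p. \<phi> (fst p) (coding_map \<phi> (snd p))) \<in> borel_measurable (?N \<Otimes>\<^sub>M ?P)"
  proof -
    have "(\<lambda>p. (fst p, coding_map \<phi> (snd p))) \<in> ?N \<Otimes>\<^sub>M ?P \<rightarrow>\<^sub>M borel \<Otimes>\<^sub>M borel" by measurable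
    from measurable_compose[OF this measurable_phi] show ?thesis by simp
  qed
  obtain B where B: "\<And>x. \<bar>f x\<bar> \<le> B"
    using compact_imp_bounded[OF compact_continuous_image[OF f compact_space]]
    unfolding bounded_iff by (auto simp: real_norm_def)
  have push: "(\<integral>x. g x \<partial>code_image \<beta>) = (\<integral>s. g (coding_map \<phi> s) \<partial>?P)"
    if "g \<in> borel_measurable borel" for g :: "'x \<Rightarrow> real"
    unfolding code_image_def by (rule integral_distr) (use that in auto)
  have slice[measurable]: "(\<lambda>x. f (\<phi> j x)) \<in> borel_measurable borel" for j
    by (intro borel_measurable_continuous_onI continuous_on_compose2[OF f] continuous_on_phi
        continuous_intros) auto
  have "(\<integral>x. f x \<partial>code_image \<beta>) = (\<integral>s. f (coding_map \<phi> s) \<partial>?P)"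
    by (rule push) simp
  also have "\<dots> = (\<integral>s. f (coding_map \<phi> s) \<partial>distr (?N \<Otimes>\<^sub>M ?P) ?P (\<lambda>p. case_nat (fst p) (snd p)))"
    by (simp only: code_law_case_nat)
  also have "\<dots> = (\<integral>p. f (coding_map \<phi> (case_nat (fst p) (snd p))) \<partial>(?N \<Otimes>\<^sub>M ?P))"
    by (rule integral_distr) measurable
  also have "\<dots> = (\<integral>p. f (\<phi> (fst p) (coding_map \<phi> (snd p))) \<partial>(?N \<Otimes>\<^sub>M ?P))"
    by (simp only: coding_map_case_nat)
  also have "\<dots> = (\<integral>j. (\<integral>s. f (\<phi> j (coding_map \<phi> s)) \<partial>?P) \<partial>?N)"
    by (subst NP.integral_fst'[symmetric])
       (auto intro!: NP.integrable_const_bound[where B=B] simp: B)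
  also have "\<dots> = (\<integral>j. (\<integral>x. f (\<phi> j x) \<partial>code_image \<beta>) \<partial>?N)"
    by (simp only: push[OF slice])
  also have "\<dots> = (\<integral>j. gibbs_weight \<nu> A \<beta> j * (\<integral>x. f (\<phi> j x) \<partial>code_image \<beta>) \<partial>\<nu>)"
  proof (rule integral_step_law)
    have "(\<lambda>j. \<integral>s. f (\<phi> j (coding_map \<phi> s)) \<partial>?P) \<in> borel_measurable ?N"
      by (rule P.borel_measurable_lebesgue_integral) (simp add: case_prod_unfold)
    then show "(\<lambda>j. \<integral>x. f (\<phi> j x) \<partial>code_image \<beta>) \<in> borel_measurable borel"
      unfolding push[OF slice] by (simp cong: measurable_cong_sets)
  qed
  finally show "(\<integral>x. f x \<partial>code_image \<beta>)
      = (\<integral>j. gibbs_weight \<nu> A \<beta> j * (\<integral>x. f (\<phi> j x) \<partial>code_image \<beta>) \<partial>\<nu>)" .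
qed

lemma continuous_integral_phi:
  assumes M: "borel_probability M" and f: "L-lipschitz_on UNIV (f :: 'x \<Rightarrow> real)"
  shows "continuous_on UNIV (\<lambda>j. \<integral>x. f (\<phi> j x) \<partial>M)"
proof (rule lipschitz_on_continuous_on)
  interpret prob_space M using M by (simp add: borel_probability_def)
  have int: "integrable M (\<lambda>x. f (\<phi> j x))" for j
    by (intro integrable_continuous_compact[OF compact_space M] continuous_on_compose2[OF
        lipschitz_on_continuous_on[OF f]] continuous_on_phi continuous_intros) auto
  show "(L * \<gamma>)-lipschitz_on UNIV (\<lambda>j. \<integral>x. f (\<phi> j x) \<partial>M)"
  proof (rule lipschitz_onI)
    fix i j
    have "\<bar>f (\<phi> i x) - f (\<phi> j x)\<bar> \<le> L * \<gamma> * dist i j" for x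
    proof -
      have "\<bar>f (\<phi> i x) - f (\<phi> j x)\<bar> \<le> L * dist (\<phi> i x) (\<phi> j x)"
        using lipschitz_onD[OF f, of "\<phi> i x" "\<phi> j x"] by (simp add: dist_real_def)
      also have "\<dots> \<le> L * (\<gamma> * dist i j)"
        using contract[of i x j x] lipschitz_on_nonneg[OF f] by (intro mult_left_mono) auto
      finally show ?thesis by simp
    qed
    then have "\<bar>(\<integral>x. f (\<phi> i x) \<partial>M) - (\<integral>x. f (\<phi> j x) \<partial>M)\<bar> \<le> (\<integral>x. L * \<gamma> * dist i j \<partial>M)"
      by (intro abs_integral_diff_le int) auto
    then show "dist (\<integral>x. f (\<phi> i x) \<partial>M) (\<integral>x. f (\<phi> j x) \<partial>M) \<le> L * \<gamma> * dist i j"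
      by (simp add: dist_real_def prob_space)
  qed (use \<gamma> lipschitz_on_nonneg[OF f] in auto)
qed

text \<open>
  Applying the Gibbs equation to both probabilities expresses the difference of their integrals of \<open>f\<close>
  as a weighted average of the differences for \<open>f \<circ> \<phi> j\<close>, which have a Lipschitz constant smaller by the
  factor \<open>\<gamma>\<close>. Iterating gives the power \<open>\<gamma> ^ n\<close>; at \<open>n = 0\<close> both integrals lie within \<open>L\<close> times the
  diameter of any fixed value of \<open>f\<close>.
\<close>
lemma gibbs_discrepancy:
  assumes G: "is_gibbs_probability \<nu> \<phi> A \<beta> \<rho>" "is_gibbs_probability \<nu> \<phi> A \<beta> \<rho>'"
    and f: "L-lipschitz_on UNIV (f :: 'x \<Rightarrow> real)"
  shows "\<bar>(\<integral>x. f x \<partial>\<rho>) - (\<integral>x. f x \<partial>\<rho>')\<bar> \<le> \<gamma> ^ n * (2 * L * diameter (UNIV :: 'x set))"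
  using f
proof (induction n arbitrary: f L)
  case 0
  note f = \<open>L-lipschitz_on UNIV f\<close>
  have near: "\<bar>(\<integral>x. f x \<partial>M) - f x0\<bar> \<le> L * diameter (UNIV :: 'x set)"
    if "is_gibbs_probability \<nu> \<phi> A \<beta> M" for M x0
  proof -
    have M: "borel_probability M" using that by (simp add: is_gibbs_probability_def)
    interpret prob_space M using M by (simp add: borel_probability_def)
    have "\<bar>f x - f x0\<bar> \<le> L * diameter (UNIV :: 'x set)" for x
    proof -
      have "\<bar>f x - f x0\<bar> \<le> L * dist x x0"
        using lipschitz_onD[OF f, of x x0] by (simp add: dist_real_def)
      also have "\<dots> \<le> L * diameter (UNIV :: 'x set)"
        using lipschitz_on_nonneg[OF f] by (intro mult_left_mono dist_le_diameter)
      finally show ?thesis .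
    qed
    then have "\<bar>(\<integral>x. f x \<partial>M) - (\<integral>x. f x0 \<partial>M)\<bar> \<le> (\<integral>x. L * diameter (UNIV :: 'x set) \<partial>M)"
      by (intro abs_integral_diff_le integrable_continuous_compact[OF compact_space M]
          lipschitz_on_continuous_on[OF f]) auto
    then show ?thesis by (simp add: prob_space)
  qed
  show ?case using near[OF G(1), of undefined] near[OF G(2), of undefined] by simp
next
  case (Suc n)
  note f = \<open>L-lipschitz_on UNIV f\<close>
  let ?c = "\<gamma> ^ n * (2 * (L * \<gamma>) * diameter (UNIV :: 'x set))"
  have lip: "(L * \<gamma>)-lipschitz_on UNIV (\<lambda>x. f (\<phi> j x))" for j
  proof (rule lipschitz_onI)
    fix x y
    have "dist (f (\<phi> j x)) (f (\<phi> j y)) \<le> L * dist (\<phi> j x) (\<phi> j y)"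
      using lipschitz_onD[OF f] by simp
    also have "\<dots> \<le> L * (\<gamma> * dist x y)"
      using contract[of j x j y] lipschitz_on_nonneg[OF f] by (intro mult_left_mono) auto
    finally show "dist (f (\<phi> j x)) (f (\<phi> j y)) \<le> L * \<gamma> * dist x y" by simp
  qed (use \<gamma> lipschitz_on_nonneg[OF f] in auto)
  have borel: "borel_probability \<rho>" "borel_probability \<rho>'"
    using G by (simp_all add: is_gibbs_probability_def)
  have eq: "(\<integral>x. f x \<partial>M) = (\<integral>j. gibbs_weight \<nu> A \<beta> j * (\<integral>x. f (\<phi> j x) \<partial>M) \<partial>\<nu>)"
    if "is_gibbs_probability \<nu> \<phi> A \<beta> M" for M
    using that lipschitz_on_continuous_on[OF f] by (auto simp: is_gibbs_probability_def)
  have "\<bar>(\<integral>x. f x \<partial>\<rho>) - (\<integral>x. f x \<partial>\<rho>')\<bar> \<le> (\<integral>j. gibbs_weight \<nu> A \<beta> j * ?c \<partial>\<nu>)"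
    unfolding eq[OF G(1)] eq[OF G(2)]
  proof (intro abs_integral_diff_le integrable_weight_times continuous_integral_phi[OF _ f] borel)
    fix j
    have "\<bar>(\<integral>x. f (\<phi> j x) \<partial>\<rho>) - (\<integral>x. f (\<phi> j x) \<partial>\<rho>')\<bar> \<le> ?c"
      by (rule Suc.IH[OF lip])
    from mult_left_mono[OF this less_imp_le[OF gibbs_weight_pos[of \<beta> j]]]
    show "\<bar>gibbs_weight \<nu> A \<beta> j * (\<integral>x. f (\<phi> j x) \<partial>\<rho>) - gibbs_weight \<nu> A \<beta> j * (\<integral>x. f (\<phi> j x) \<partial>\<rho>')\<bar>
        \<le> gibbs_weight \<nu> A \<beta> j * ?c"
      using gibbs_weight_pos[of \<beta> j] by (simp add: abs_mult flip: right_diff_distrib)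
  qed simp
  then show ?case by (simp add: integral_gibbs_weight mult_ac)
qed

lemma gibbs_unique:
  assumes G: "is_gibbs_probability \<nu> \<phi> A \<beta> \<rho>" "is_gibbs_probability \<nu> \<phi> A \<beta> \<rho>'"
  shows "\<rho> = \<rho>'"
proof (rule measure_eqI_lipschitz)
  fix L :: real and f :: "'x \<Rightarrow> real" assume f: "L-lipschitz_on UNIV f"
  have "\<bar>(\<integral>x. f x \<partial>\<rho>) - (\<integral>x. f x \<partial>\<rho>')\<bar> \<le> 0"
    by (rule LIMSEQ_le_const[OF gamma_power_tendsto[of "2 * L * diameter (UNIV :: 'x set)"]])
       (use gibbs_discrepancy[OF G f] in blast)
  then show "(\<integral>x. f x \<partial>\<rho>) = (\<integral>x. f x \<partial>\<rho>')" by simp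
qed (use G in \<open>auto simp: is_gibbs_probability_def\<close>)

lemma gibbs_probability_eq: "gibbs_probability \<nu> \<phi> A \<beta> = code_image \<beta>"
  unfolding gibbs_probability_def
  by (rule the_equality) (auto intro: is_gibbs_code_image gibbs_unique)


section \<open>Sums of the normalized potential along codes\<close>

abbreviation potential :: "'j \<Rightarrow> real" where "potential \<equiv> normalized_potential A"

lemma bdd_above_A: "bdd_above (range A)"
  by (intro bounded_imp_bdd_above compact_imp_bounded compact_continuous_image continuous_A compact_index)

lemma potential_nonpos: "potential j \<le> 0"
  unfolding normalized_potential_def using cSUP_upper[OF _ bdd_above_A, of j] by simp

lemma continuous_potential: "continuous_on UNIV potential"
  unfolding normalized_potential_def by (intro continuous_intros continuous_A)

lemma measurable_potential[measurable]: "potential \<in> borel_measurable borel"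
  by (rule borel_measurable_continuous_onI[OF continuous_potential])

definition code_sum :: "nat \<Rightarrow> (nat \<Rightarrow> 'j) \<Rightarrow> real" where
  "code_sum n s = (\<Sum>k<n. potential (s k))"

lemma continuous_code_sum: "continuous_on UNIV (code_sum n)"
  unfolding code_sum_def
  by (intro continuous_on_sum continuous_on_compose2[OF continuous_potential] continuous_on_product_coordinates)
     auto

lemma code_sum_antimono: "m \<le> n \<Longrightarrow> code_sum n s \<le> code_sum m s"
proof (induction n rule: dec_induct)
  case (step n)
  then show ?case using potential_nonpos[of "s n"] by (simp add: code_sum_def)
qed simp

lemma suminf_potential: "(\<Sum>n. ereal (potential (s n))) = (INF n. ereal (code_sum n s))"
proof -
  have "decseq (\<lambda>n. ereal (code_sum n s))"
    by (auto simp: decseq_def code_sum_antimono)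
  from LIMSEQ_INF[OF this] have "(\<lambda>n. ereal (potential (s n))) sums (INF n. ereal (code_sum n s))"
    by (simp add: sums_def code_sum_def)
  then show ?thesis by (rule sums_unique[symmetric])
qed

lemma suminf_potential_le: "(\<Sum>n. ereal (potential (s n))) \<le> ereal (code_sum n s)"
  unfolding suminf_potential by (rule INF_lower) simp

lemma suminf_potential_le_rate: "(\<Sum>n. ereal (potential (s n))) \<le> - gibbs_rate \<phi> A (coding_map \<phi> s)"
  unfolding gibbs_rate_def by (auto intro: SUP_upper)

text \<open>
  This is where compactness of the code space enters the large deviation estimates. The open sets on which
  the \<open>n\<close>-th partial sum is below \<open>c\<close> increase with \<open>n\<close> because the potential is nonpositive, and by hypothesis
  they cover \<open>K\<close>; hence one of them contains \<open>K\<close>. A bound on infinite sums thereby becomes a bound on sums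
  over a fixed number of letters, for which the weights can be controlled.
\<close>
lemma code_sum_uniform_on_compact:
  assumes "compact K" "\<And>s. s \<in> K \<Longrightarrow> (\<Sum>n. ereal (potential (s n))) < ereal c"
  obtains n where "\<And>s. s \<in> K \<Longrightarrow> code_sum n s < c"
proof -
  have op: "open {s. code_sum n s < c}" for n
    using continuous_code_sum by (intro open_Collect_less) auto
  have "K \<subseteq> (\<Union>n. {s. code_sum n s < c})"
    using assms(2) by (auto simp: suminf_potential INF_less_iff)
  then obtain D where D: "finite D" "K \<subseteq> (\<Union>n\<in>D. {s. code_sum n s < c})"
    using compactE_image[OF assms(1), of UNIV] op by (metis (no_types, lifting))
  have "code_sum (Max (insert 0 D)) s < c" if s: "s \<in> K" for s
  proof -
    obtain m where m: "m \<in> D" "code_sum m s < c" using D(2) s by auto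
    have "code_sum (Max (insert 0 D)) s \<le> code_sum m s"
      using D(1) m(1) by (intro code_sum_antimono) simp
    then show ?thesis using m(2) by simp
  qed
  then show ?thesis using that by blast
qed

lemma gibbs_rate_nonneg: "0 \<le> gibbs_rate \<phi> A x"
proof -
  have "(\<Sum>n. ereal (potential (s n))) \<le> 0" for s
    using suminf_potential_le[of s 0] by (simp add: code_sum_def zero_ereal_def)
  then have "(SUP s\<in>coding_map \<phi> -` {x}. \<Sum>n. ereal (potential (s n))) \<le> 0"
    by (intro SUP_least)
  then show ?thesis unfolding gibbs_rate_def by (simp add: ereal_0_le_uminus_iff)
qed

lemma compact_coding_preimage: "closed C \<Longrightarrow> compact (coding_map \<phi> -` C)"
proof -
  assume "closed C"
  then have "closed (coding_map \<phi> -` C)"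
    by (rule closed_vimage[OF _ continuous_coding_map])
  then show ?thesis
    using compact_Int_closed[OF compact_UNIV_fun[OF compact_index]] by auto
qed

text \<open>
  If the rate exceeds \<open>c\<close> at \<open>x\<close>, then a single partial sum is below \<open>- c\<close> on the whole fibre over \<open>x\<close>. The
  codes for which this partial sum is at least \<open>- c\<close> form a compact set, whose image is closed and misses \<open>x\<close>;
  off this image the rate is at least \<open>c\<close>.
\<close>
lemma lower_semicontinuous_gibbs_rate: "lower_semicontinuous (gibbs_rate \<phi> A)"
  unfolding lower_semicontinuous_def le_Liminf_iff
proof (intro allI impI)
  fix x y assume "y < gibbs_rate \<phi> A x"
  then obtain c where c: "y < ereal c" "ereal c < gibbs_rate \<phi> A x"
    using ereal_dense2 by blast
  have K: "compact (coding_map \<phi> -` {x})" by (rule compact_coding_preimage) simp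
  have "(\<Sum>n. ereal (potential (s n))) < ereal (- c)" if "s \<in> coding_map \<phi> -` {x}" for s
  proof -
    have "(\<Sum>n. ereal (potential (s n))) \<le> - gibbs_rate \<phi> A x"
      using suminf_potential_le_rate[of s] that by simp
    also have "\<dots> < - ereal c" using c(2) by (simp only: ereal_minus_less_minus)
    finally show ?thesis by simp
  qed
  then obtain n where n: "\<And>s. s \<in> coding_map \<phi> -` {x} \<Longrightarrow> code_sum n s < - c"
    using code_sum_uniform_on_compact[OF K] by blast
  define F where "F = coding_map \<phi> ` {s. - c \<le> code_sum n s}"
  have "closed {s. - c \<le> code_sum n s}"
    using continuous_code_sum by (intro closed_Collect_le) auto
  then have "compact {s. - c \<le> code_sum n s}"
    using compact_Int_closed[OF compact_UNIV_fun[OF compact_index]] by fastforce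
  then have "compact F"
    unfolding F_def
    by (rule compact_continuous_image[OF continuous_on_subset[OF continuous_coding_map subset_UNIV]])
  then have "open (- F)" by (simp add: compact_imp_closed open_Compl)
  moreover have "x \<in> - F" using n by (force simp: F_def)
  ultimately have "eventually (\<lambda>z. z \<in> - F) (nhds x)" by (rule eventually_nhds_in_open)
  then have "eventually (\<lambda>z. z \<in> - F) (at x)" by (simp add: eventually_nhds_conv_at)
  then show "eventually (\<lambda>z. y < gibbs_rate \<phi> A z) (at x)"
  proof eventually_elim
    case (elim z)
    have "(\<Sum>k. ereal (potential (s k))) \<le> ereal (- c)" if "s \<in> coding_map \<phi> -` {z}" for s
    proof -
      have "code_sum n s < - c" using elim that by (force simp: F_def)
      then show ?thesis using suminf_potential_le[of s n] by (meson ereal_less_eq(3) less_imp_le order_trans)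
    qed
    then have "(SUP s\<in>coding_map \<phi> -` {z}. \<Sum>k. ereal (potential (s k))) \<le> ereal (- c)"
      by (rule SUP_least)
    then have "- ereal (- c) \<le> gibbs_rate \<phi> A z"
      unfolding gibbs_rate_def by (simp only: ereal_minus_le_minus)
    then show ?case using c(1) by (simp add: less_le_trans)
  qed
qed

section \<open>Two-sided bounds on the Gibbs weight\<close>

text \<open>
  The partition function is at most \<open>exp (\<beta> * m)\<close>, with \<open>m\<close> the maximum of \<open>A\<close>.
\<close>
lemma gibbs_weight_lower:
  assumes "0 < \<beta>" shows "exp (\<beta> * potential j) \<le> gibbs_weight \<nu> A \<beta> j"
proof -
  define m where "m = (SUP i. A i)"
  have "(\<integral>i. exp (\<beta> * A i) \<partial>\<nu>) \<le> (\<integral>i. exp (\<beta> * m) \<partial>\<nu>)"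
    using assms cSUP_upper[OF _ bdd_above_A]
    by (intro integral_mono integrable_continuous_compact[OF compact_index borel_nu] continuous_intros continuous_A)
       (auto simp: m_def)
  then have le: "(\<integral>i. exp (\<beta> * A i) \<partial>\<nu>) \<le> exp (\<beta> * m)" by (simp add: \<nu>.prob_space)
  have "exp (\<beta> * potential j) = exp (\<beta> * A j) / exp (\<beta> * m)"
    by (simp add: normalized_potential_def m_def right_diff_distrib exp_diff)
  also have "\<dots> \<le> gibbs_weight \<nu> A \<beta> j"
    unfolding gibbs_weight_def using le partition_pos[of \<beta>] by (intro divide_left_mono) auto
  finally show ?thesis .
qed

definition near_max_mass :: "real \<Rightarrow> real" where
  "near_max_mass \<epsilon> = measure \<nu> {j. - \<epsilon> < potential j}"

lemma open_measure_pos: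
  assumes "open U" "j \<in> U" shows "0 < measure \<nu> U"
proof -
  have "0 < emeasure \<nu> U" using full_support assms by (auto simp: measure_supp_def)
  then show ?thesis by (simp add: \<nu>.emeasure_eq_measure)
qed

lemma near_max_mass_pos:
  assumes "0 < \<epsilon>" shows "0 < near_max_mass \<epsilon>"
proof -
  have "(SUP i. A i) - \<epsilon> < (SUP i. A i)" using assms by simp
  then obtain j where "(SUP i. A i) - \<epsilon> < A j"
    using less_cSUP_iff[OF _ bdd_above_A] by auto
  then have "j \<in> {j. - \<epsilon> < potential j}" by (simp add: normalized_potential_def)
  moreover have "open {j. - \<epsilon> < potential j}"
    using continuous_potential by (intro open_Collect_less) auto
  ultimately show ?thesis unfolding near_max_mass_def by (rule open_measure_pos[rotated])
qed

text \<open>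
  The partition function is at least its part over the letters where the potential exceeds \<open>- \<epsilon>\<close>, whose mass
  is positive by full support. The resulting factor \<open>near_max_mass \<epsilon>\<close> is independent of \<open>\<beta>\<close>, hence invisible on
  the scale \<open>1 / \<beta>\<close>.
\<close>
lemma gibbs_weight_upper:
  assumes "0 < \<beta>" "0 < \<epsilon>"
  shows "gibbs_weight \<nu> A \<beta> j \<le> exp (\<beta> * (potential j + \<epsilon>)) / near_max_mass \<epsilon>"
proof -
  define m where "m = (SUP i. A i)"
  let ?N = "{j. - \<epsilon> < potential j}"
  have [measurable]: "?N \<in> sets borel" by measurable
  have "near_max_mass \<epsilon> * exp (\<beta> * (m - \<epsilon>)) = (\<integral>i. indicat_real ?N i * exp (\<beta> * (m - \<epsilon>)) \<partial>\<nu>)"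
    by (simp add: near_max_mass_def sets_nu)
  also have "\<dots> \<le> (\<integral>i. exp (\<beta> * A i) \<partial>\<nu>)"
  proof (rule integral_mono)
    show "integrable \<nu> (\<lambda>i. exp (\<beta> * A i))"
      by (intro integrable_continuous_compact[OF compact_index borel_nu] continuous_intros continuous_A)
    show "integrable \<nu> (\<lambda>i. indicat_real ?N i * exp (\<beta> * (m - \<epsilon>)))"
      by (intro integrable_mult_left integrable_real_indicator) (auto simp: sets_nu \<nu>.emeasure_eq_measure)
    show "indicat_real ?N i * exp (\<beta> * (m - \<epsilon>)) \<le> exp (\<beta> * A i)" for i
      using assms by (auto simp: indicator_def normalized_potential_def m_def)
  qed
  finally have le: "near_max_mass \<epsilon> * exp (\<beta> * (m - \<epsilon>)) \<le> (\<integral>i. exp (\<beta> * A i) \<partial>\<nu>)" .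
  have "gibbs_weight \<nu> A \<beta> j \<le> exp (\<beta> * A j) / (near_max_mass \<epsilon> * exp (\<beta> * (m - \<epsilon>)))"
    unfolding gibbs_weight_def using le near_max_mass_pos[OF assms(2)] partition_pos[of \<beta>]
    by (intro divide_left_mono) auto
  also have "\<dots> = exp (\<beta> * (potential j + \<epsilon>)) / near_max_mass \<epsilon>"
    by (simp add: normalized_potential_def m_def field_simps exp_diff exp_add)
  finally show ?thesis .
qed

section \<open>Upper bound on closed sets\<close>

lemma nn_integral_code_law_prod:
  assumes [measurable]: "g \<in> borel_measurable borel"
  shows "(\<integral>\<^sup>+s. (\<Prod>k<n. g (s k)) \<partial>code_law \<beta>) = (\<integral>\<^sup>+j. g j \<partial>step_law \<beta>) ^ n"
proof (induction n)
  case 0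
  interpret prob_space "code_law \<beta>" by (rule prob_space_code_law)
  show ?case using emeasure_space_1 by simp
next
  case (Suc n)
  let ?N = "step_law \<beta>" and ?P = "code_law \<beta>"
  interpret P: prob_space ?P by (rule prob_space_code_law)
  have [measurable]: "(\<lambda>s. g (s k)) \<in> borel_measurable ?P" for k
    by measurable
  have "(\<integral>\<^sup>+s. (\<Prod>k<Suc n. g (s k)) \<partial>?P)
      = (\<integral>\<^sup>+s. (\<Prod>k<Suc n. g (s k)) \<partial>distr (?N \<Otimes>\<^sub>M ?P) ?P (\<lambda>p. case_nat (fst p) (snd p)))"
    by (simp only: code_law_case_nat)
  also have "\<dots> = (\<integral>\<^sup>+p. (\<Prod>k<Suc n. g (case_nat (fst p) (snd p) k)) \<partial>(?N \<Otimes>\<^sub>M ?P))"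
    by (rule nn_integral_distr) measurable
  also have "\<dots> = (\<integral>\<^sup>+p. g (fst p) * (\<Prod>k<n. g (snd p k)) \<partial>(?N \<Otimes>\<^sub>M ?P))"
    by (simp only: prod.lessThan_Suc_shift nat.case)
  also have "\<dots> = (\<integral>\<^sup>+j. \<integral>\<^sup>+s. g j * (\<Prod>k<n. g (s k)) \<partial>?P \<partial>?N)"
    by (subst P.nn_integral_fst[symmetric]) simp_all
  also have "\<dots> = (\<integral>\<^sup>+j. g j * (\<integral>\<^sup>+j. g j \<partial>?N) ^ n \<partial>?N)"
    by (simp add: nn_integral_cmult Suc.IH)
  also have "\<dots> = (\<integral>\<^sup>+j. g j \<partial>?N) ^ Suc n"
    by (simp add: nn_integral_multc)
  finally show ?case .
qed

lemma sets_code_sum_le: "{s. code_sum n s \<le> c} \<in> sets (code_law \<beta>)"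
proof -
  have [measurable]: "code_sum n \<in> borel_measurable (code_law \<beta>)" unfolding code_sum_def by measurable
  have "{s \<in> space (code_law \<beta>). code_sum n s \<le> c} \<in> sets (code_law \<beta>)" by measurable
  then show ?thesis by simp
qed

text \<open>
  An exponential Markov inequality with parameter \<open>\<beta>\<close> itself: by independence the expectation of
  \<open>exp (- \<beta> * code_sum n s)\<close> is an \<open>n\<close>-th power, and in each factor the exponential cancels the one in the
  Gibbs weight, leaving only the quotient of normalizations.
\<close>
lemma code_sum_tail_bound:
  assumes "0 < \<beta>" "0 < \<epsilon>"
  shows "measure (code_law \<beta>) {s. code_sum n s \<le> c} \<le> exp (\<beta> * c) * (exp (\<beta> * \<epsilon>) / near_max_mass \<epsilon>) ^ n"
proof -
  let ?P = "code_law \<beta>" and ?g = "\<lambda>j. ennreal (exp (- \<beta> * potential j))"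
  let ?r = "exp (\<beta> * \<epsilon>) / near_max_mass \<epsilon>"
  have r: "0 \<le> ?r" using near_max_mass_pos[OF assms(2)] by simp
  interpret P: prob_space ?P by (rule prob_space_code_law)
  have "(\<integral>\<^sup>+j. ?g j \<partial>step_law \<beta>) = (\<integral>\<^sup>+j. ennreal (gibbs_weight \<nu> A \<beta> j) * ?g j \<partial>\<nu>)"
    by (rule nn_integral_step_law) measurable
  also have "\<dots> \<le> (\<integral>\<^sup>+j. ennreal ?r \<partial>\<nu>)"
  proof (rule nn_integral_mono)
    fix j
    have "gibbs_weight \<nu> A \<beta> j * exp (- \<beta> * potential j)
        \<le> exp (\<beta> * (potential j + \<epsilon>)) / near_max_mass \<epsilon> * exp (- \<beta> * potential j)"
      by (intro mult_right_mono gibbs_weight_upper assms) simp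
    also have "\<dots> = ?r" by (simp add: distrib_left exp_add exp_minus field_simps)
    finally show "ennreal (gibbs_weight \<nu> A \<beta> j) * ?g j \<le> ennreal ?r"
      using gibbs_weight_pos[of \<beta> j] by (simp add: ennreal_mult[symmetric] less_imp_le ennreal_leI)
  qed
  also have "\<dots> = ennreal ?r" by (simp add: \<nu>.emeasure_space_1)
  finally have step: "(\<integral>\<^sup>+j. ?g j \<partial>step_law \<beta>) \<le> ennreal ?r" .
  have "emeasure ?P {s. code_sum n s \<le> c} = (\<integral>\<^sup>+s. indicator {s. code_sum n s \<le> c} s \<partial>?P)"
    by (rule nn_integral_indicator[symmetric]) (rule sets_code_sum_le)
  also have "\<dots> \<le> (\<integral>\<^sup>+s. ennreal (exp (\<beta> * c)) * (\<Prod>k<n. ?g (s k)) \<partial>?P)"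
  proof (rule nn_integral_mono)
    fix s
    have "ennreal (exp (\<beta> * c)) * (\<Prod>k<n. ?g (s k)) = ennreal (exp (\<beta> * c) * (\<Prod>k<n. exp (- \<beta> * potential (s k))))"
      by (simp add: prod_ennreal ennreal_mult prod_nonneg)
    also have "exp (\<beta> * c) * (\<Prod>k<n. exp (- \<beta> * potential (s k))) = exp (\<beta> * (c - code_sum n s))"
      by (simp add: exp_sum[symmetric] code_sum_def sum_negf sum_distrib_left right_diff_distrib
          flip: exp_add)
    finally have eq: "ennreal (exp (\<beta> * c)) * (\<Prod>k<n. ?g (s k)) = ennreal (exp (\<beta> * (c - code_sum n s)))" .
    show "indicator {s. code_sum n s \<le> c} s \<le> ennreal (exp (\<beta> * c)) * (\<Prod>k<n. ?g (s k))"
      unfolding eq using assms(1) by (auto simp: indicator_def)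
  qed
  also have "\<dots> = ennreal (exp (\<beta> * c)) * (\<integral>\<^sup>+s. (\<Prod>k<n. ?g (s k)) \<partial>?P)"
    by (rule nn_integral_cmult) measurable
  also have "\<dots> = ennreal (exp (\<beta> * c)) * (\<integral>\<^sup>+j. ?g j \<partial>step_law \<beta>) ^ n"
    by (subst nn_integral_code_law_prod) measurable
  also have "\<dots> \<le> ennreal (exp (\<beta> * c)) * ennreal ?r ^ n"
    by (intro mult_left_mono power_mono step) auto
  also have "\<dots> = ennreal (exp (\<beta> * c) * ?r ^ n)"
    using r by (simp add: ennreal_power ennreal_mult)
  finally show ?thesis
    using r by (simp add: P.emeasure_eq_measure)
qed

lemma measure_code_image:
  "B \<in> sets borel \<Longrightarrow> measure (code_image \<beta>) B = measure (code_law \<beta>) (coding_map \<phi> -` B)"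
  unfolding code_image_def by (subst measure_distr) simp_all

text \<open>
  For \<open>c\<close> above minus the infimum of the rate on \<open>C\<close>, all codes of points of \<open>C\<close> have an \<open>n\<close>-th partial
  sum below \<open>c\<close>, for one and the same \<open>n\<close>. The tail bound then gives the exponential rate \<open>c\<close> up to the error
  \<open>n * \<epsilon>\<close>, which is arbitrarily small because \<open>n\<close> is chosen before \<open>\<epsilon>\<close>.
\<close>
lemma ldp_upper_bound:
  assumes "closed C"
  shows "Limsup at_top (\<lambda>\<beta>. ereal (1 / \<beta>) * log_ereal (measure (code_image \<beta>) C)) \<le> - (INF x\<in>C. gibbs_rate \<phi> A x)"
  unfolding Limsup_le_iff
proof (intro allI impI)
  fix y assume "- (INF x\<in>C. gibbs_rate \<phi> A x) < y"
  then obtain c' where c': "- (INF x\<in>C. gibbs_rate \<phi> A x) < ereal c'" "ereal c' < y"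
    using ereal_dense2 by blast
  obtain c where c: "- (INF x\<in>C. gibbs_rate \<phi> A x) < ereal c" "c < c'"
    using ereal_dense2[OF c'(1)] by auto
  have sum_less: "(\<Sum>n. ereal (potential (s n))) < ereal c" if "s \<in> coding_map \<phi> -` C" for s
  proof -
    have "(INF x\<in>C. gibbs_rate \<phi> A x) \<le> gibbs_rate \<phi> A (coding_map \<phi> s)"
      using that by (intro INF_lower) simp
    then have "- gibbs_rate \<phi> A (coding_map \<phi> s) \<le> - (INF x\<in>C. gibbs_rate \<phi> A x)"
      by (simp only: ereal_minus_le_minus)
    then show ?thesis using suminf_potential_le_rate[of s] c(1) by (meson le_less_trans order_trans)
  qed
  obtain n where n: "\<And>s. s \<in> coding_map \<phi> -` C \<Longrightarrow> code_sum n s < c"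
    using code_sum_uniform_on_compact[OF compact_coding_preimage[OF assms] sum_less] by blast
  \<comment> \<open>Half of the gap between \<open>c\<close> and \<open>c'\<close> pays for the \<open>n\<close> errors \<open>\<epsilon>\<close>, the other half for the masses.
      The denominator \<open>n + 1\<close> covers the case \<open>n = 0\<close>.\<close>
  define \<epsilon> where "\<epsilon> = (c' - c) / (2 * (real n + 1))"
  have \<epsilon>: "0 < \<epsilon>" "real n * \<epsilon> \<le> (c' - c) / 2" using c(2) by (auto simp: \<epsilon>_def field_simps)
  define p where "p = near_max_mass \<epsilon>"
  have p: "0 < p" unfolding p_def by (rule near_max_mass_pos[OF \<epsilon>(1)])
  define u where "u = - (real n * ln p)"
  have "((\<lambda>\<beta>. u / \<beta>) \<longlongrightarrow> 0) at_top"
    by (intro tendsto_divide_0[OF tendsto_const] filterlim_at_top_imp_at_infinity filterlim_ident)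
  then have "eventually (\<lambda>\<beta>. u / \<beta> < (c' - c) / 2) at_top"
    using c(2) by (intro order_tendstoD(2)) auto
  then show "eventually (\<lambda>\<beta>. ereal (1 / \<beta>) * log_ereal (measure (code_image \<beta>) C) < y) at_top"
    using eventually_gt_at_top[of 0]
  proof eventually_elim
    case (elim \<beta>)
    then have \<beta>: "0 < \<beta>" by simp
    interpret P: prob_space "code_law \<beta>" by (rule prob_space_code_law)
    have "measure (code_image \<beta>) C = measure (code_law \<beta>) (coding_map \<phi> -` C)"
      using assms by (simp add: measure_code_image)
    also have "\<dots> \<le> measure (code_law \<beta>) {s. code_sum n s \<le> c}"
    proof (rule P.finite_measure_mono)
      show "coding_map \<phi> -` C \<subseteq> {s. code_sum n s \<le> c}" using n by (auto intro: less_imp_le)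
    qed (rule sets_code_sum_le)
    also have "\<dots> \<le> exp (\<beta> * c) * (exp (\<beta> * \<epsilon>) / p) ^ n"
      unfolding p_def by (rule code_sum_tail_bound[OF \<beta> \<epsilon>(1)])
    finally have le: "measure (code_image \<beta>) C \<le> exp (\<beta> * c) * (exp (\<beta> * \<epsilon>) / p) ^ n" .
    show ?case
    proof (cases "measure (code_image \<beta>) C = 0")
      case True
      then show ?thesis using \<beta> c'(2) by (auto simp: log_ereal_def)
    next
      case False
      then have pos: "0 < measure (code_image \<beta>) C" using measure_nonneg[of "code_image \<beta>" C] by linarith
      have "ln (measure (code_image \<beta>) C) \<le> ln (exp (\<beta> * c) * (exp (\<beta> * \<epsilon>) / p) ^ n)"
        using pos le p by (intro ln_mono) auto
      also have "\<dots> = \<beta> * c + real n * (\<beta> * \<epsilon> - ln p)"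
        using p by (simp add: ln_mult ln_div ln_realpow)
      finally have "ln (measure (code_image \<beta>) C) / \<beta> \<le> (\<beta> * c + real n * (\<beta> * \<epsilon> - ln p)) / \<beta>"
        using \<beta> by (intro divide_right_mono) auto
      also have "\<dots> = c + real n * \<epsilon> + u / \<beta>"
        using \<beta> by (simp add: u_def field_simps)
      also have "\<dots> < c'"
        using add_le_less_mono[OF \<epsilon>(2) elim(1)] by (simp only: field_sum_of_halves less_diff_eq add_ac)
      finally have "ereal (ln (measure (code_image \<beta>) C) / \<beta>) < y" using c'(2) by (simp add: less_trans[of _ "ereal c'"])
      then show ?thesis using False by (simp add: log_ereal_def)
    qed
  qed
qed

section \<open>Lower bound on open sets\<close>

lemma cylinder_lower_bound:
  assumes "0 < \<beta>" and B: "\<And>k. B k \<in> sets borel" and b: "\<And>k j. j \<in> B k \<Longrightarrow> b k \<le> potential j"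
  shows "exp (\<beta> * (\<Sum>k<n. b k)) * (\<Prod>k<n. measure \<nu> (B k)) \<le> measure (code_law \<beta>) {s. \<forall>k<n. s k \<in> B k}"
proof -
  interpret S: sequence_space "step_law \<beta>" by (rule sequence_space_step_law)
  interpret P: prob_space "code_law \<beta>" by (rule prob_space_code_law)
  have step: "exp (\<beta> * b k) * measure \<nu> (B k) \<le> measure (step_law \<beta>) (B k)" for k
  proof -
    have "ennreal (exp (\<beta> * b k)) * emeasure \<nu> (B k) = (\<integral>\<^sup>+j. ennreal (exp (\<beta> * b k)) * indicator (B k) j \<partial>\<nu>)"
      using B by (simp add: nn_integral_cmult_indicator sets_nu)
    also have "\<dots> \<le> (\<integral>\<^sup>+j. ennreal (gibbs_weight \<nu> A \<beta> j) * indicator (B k) j \<partial>\<nu>)"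
    proof (rule nn_integral_mono)
      fix j
      show "ennreal (exp (\<beta> * b k)) * indicator (B k) j \<le> ennreal (gibbs_weight \<nu> A \<beta> j) * indicator (B k) j"
      proof (cases "j \<in> B k")
        case True
        then have "exp (\<beta> * b k) \<le> exp (\<beta> * potential j)" using b assms(1) by simp
        also have "\<dots> \<le> gibbs_weight \<nu> A \<beta> j" by (rule gibbs_weight_lower[OF assms(1)])
        finally show ?thesis using True by (simp add: ennreal_leI)
      qed simp
    qed
    also have "\<dots> = emeasure (step_law \<beta>) (B k)"
      unfolding step_law_def using B by (subst emeasure_density) (auto simp: sets_nu)
    finally show ?thesis
      by (simp add: S.M.emeasure_eq_measure \<nu>.emeasure_eq_measure ennreal_mult[symmetric])
  qed
  have "emeasure (code_law \<beta>) {s. \<forall>k<n. s k \<in> B k} = (\<Prod>k<n. emeasure (step_law \<beta>) (B k))"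
    using S.emeasure_PiM_Collect[of "{..<n}" B] B
    by (simp add: code_law_def[symmetric] Ball_def)
  then have eq: "measure (code_law \<beta>) {s. \<forall>k<n. s k \<in> B k} = (\<Prod>k<n. measure (step_law \<beta>) (B k))"
    by (simp add: P.emeasure_eq_measure S.M.emeasure_eq_measure prod_ennreal prod_nonneg)
  have "exp (\<beta> * (\<Sum>k<n. b k)) * (\<Prod>k<n. measure \<nu> (B k)) = (\<Prod>k<n. exp (\<beta> * b k) * measure \<nu> (B k))"
    by (simp add: sum_distrib_left exp_sum prod.distrib)
  also have "\<dots> \<le> (\<Prod>k<n. measure (step_law \<beta>) (B k))"
    by (intro prod_mono) (simp add: step)
  finally show ?thesis by (simp add: eq)
qed

text \<open>
  Take a code \<open>s\<close> of a point of \<open>U\<close>. By continuity of the coding map, \<open>U\<close> contains the points coded by a whole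
  cylinder around \<open>s\<close> that restricts only the first \<open>n\<close> letters. After shrinking, the potential on it is within \<open>\<eta>\<close>
  of that of \<open>s\<close> at each letter, so its probability is at least \<open>exp (\<beta> * (code_sum n s - n * \<eta>))\<close> times the
  \<open>\<nu>\<close>-masses of its sides. These are positive by full support and do not depend on \<open>\<beta>\<close>.
\<close>
lemma ldp_lower_bound:
  assumes "open U"
  shows "- (INF x\<in>U. gibbs_rate \<phi> A x) \<le> Liminf at_top (\<lambda>\<beta>. ereal (1 / \<beta>) * log_ereal (measure (code_image \<beta>) U))"
  unfolding le_Liminf_iff
proof (intro allI impI)
  fix y assume "y < - (INF x\<in>U. gibbs_rate \<phi> A x)"
  then have "(INF x\<in>U. gibbs_rate \<phi> A x) < - y" by (simp add: ereal_less_uminus_reorder)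
  then obtain x where x: "x \<in> U" "gibbs_rate \<phi> A x < - y" by (auto simp: INF_less_iff)
  then have "y < (SUP s\<in>coding_map \<phi> -` {x}. \<Sum>n. ereal (potential (s n)))"
    unfolding gibbs_rate_def by (simp only: ereal_minus_less_minus)
  then obtain s where s: "coding_map \<phi> s = x" "y < (\<Sum>n. ereal (potential (s n)))"
    by (auto simp: less_SUP_iff)
  obtain c' where c': "y < ereal c'" "ereal c' < (\<Sum>n. ereal (potential (s n)))"
    using ereal_dense2[OF s(2)] by blast
  obtain c where c: "y < ereal c" "c < c'"
    using ereal_dense2[OF c'(1)] by auto
  have sum_ge: "c' < code_sum n s" for n
    using less_le_trans[OF c'(2) suminf_potential_le[of s n]] by simp
  have "open (coding_map \<phi> -` U)" by (rule open_vimage[OF assms continuous_coding_map])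
  then have op: "openin (product_topology (\<lambda>_::nat. euclidean :: 'j topology) UNIV) (coding_map \<phi> -` U)"
    by (simp add: euclidean_product_topology)
  have "s \<in> coding_map \<phi> -` U" using s x by simp
  from product_topology_open_contains_basis[OF op this]
  obtain X where X: "s \<in> PiE UNIV X" "\<And>i. openin (euclidean :: 'j topology) (X i)"
      "finite {i. X i \<noteq> topspace (euclidean :: 'j topology)}" "PiE UNIV X \<subseteq> coding_map \<phi> -` U"
    by (elim exE conjE) blast
  obtain n where n: "\<And>i. n \<le> i \<Longrightarrow> X i = UNIV"
  proof -
    obtain n where "\<And>i. i \<in> {i. X i \<noteq> topspace (euclidean :: 'j topology)} \<Longrightarrow> i < n"
      using finite_nat_bounded[OF X(3)] by blast
    then show ?thesis using that[of n] by (metis (mono_tags, lifting) mem_Collect_eq not_less topspace_euclidean)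
  qed
  define \<eta> where "\<eta> = (c' - c) / (2 * (real n + 1))"
  have \<eta>: "0 < \<eta>" "real n * \<eta> \<le> (c' - c) / 2" using c(2) by (auto simp: \<eta>_def field_simps)
  define B where "B k = X k \<inter> {j. potential (s k) - \<eta> < potential j}" for k
  have openB: "open (B k)" for k
    unfolding B_def using X(2) continuous_potential by (intro open_Int open_Collect_less) auto
  have "s k \<in> B k" for k using X(1) \<eta>(1) by (auto simp: B_def PiE_iff)
  then have posB: "0 < measure \<nu> (B k)" for k by (rule open_measure_pos[OF openB])
  define p where "p = (\<Prod>k<n. measure \<nu> (B k))"
  have p: "0 < p" unfolding p_def by (intro prod_pos) (simp add: posB)
  have sub: "{t. \<forall>k<n. t k \<in> B k} \<subseteq> coding_map \<phi> -` U"
  proof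
    fix t assume t: "t \<in> {t. \<forall>k<n. t k \<in> B k}"
    have "t k \<in> X k" for k using t n[of k] by (cases "k < n") (auto simp: B_def)
    then show "t \<in> coding_map \<phi> -` U" using X(4) by (auto simp: PiE_iff)
  qed
  have "((\<lambda>\<beta>. ln p / \<beta>) \<longlongrightarrow> 0) at_top"
    by (intro tendsto_divide_0[OF tendsto_const] filterlim_at_top_imp_at_infinity filterlim_ident)
  then have "eventually (\<lambda>\<beta>. - ((c' - c) / 2) < ln p / \<beta>) at_top"
    using c(2) by (intro order_tendstoD(1)) auto
  then show "eventually (\<lambda>\<beta>. y < ereal (1 / \<beta>) * log_ereal (measure (code_image \<beta>) U)) at_top"
    using eventually_gt_at_top[of 0]
  proof eventually_elim
    case (elim \<beta>)
    then have \<beta>: "0 < \<beta>" by simp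
    interpret P: prob_space "code_law \<beta>" by (rule prob_space_code_law)
    let ?S = "\<Sum>k<n. potential (s k) - \<eta>"
    have "exp (\<beta> * ?S) * p \<le> measure (code_law \<beta>) {t. \<forall>k<n. t k \<in> B k}"
      unfolding p_def using openB
      by (intro cylinder_lower_bound[OF \<beta>]) (auto simp: B_def)
    also have "\<dots> \<le> measure (code_law \<beta>) (coding_map \<phi> -` U)"
      using measurable_sets[OF measurable_coding_map'[of \<beta>] borel_open[OF assms]]
      by (intro P.finite_measure_mono sub) simp
    also have "\<dots> = measure (code_image \<beta>) U"
      using assms by (simp add: measure_code_image)
    finally have le: "exp (\<beta> * ?S) * p \<le> measure (code_image \<beta>) U" .
    have pos: "0 < exp (\<beta> * ?S) * p" using p by simp
    have "c < code_sum n s - real n * \<eta> + ln p / \<beta>"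
    proof -
      have "c' - (c' - c) / 2 + - ((c' - c) / 2) < (code_sum n s - real n * \<eta>) + ln p / \<beta>"
        using \<eta>(2) sum_ge[of n] by (intro add_strict_mono elim(1)) linarith
      then show ?thesis by (simp add: field_simps)
    qed
    also have "\<dots> = (\<beta> * ?S + ln p) / \<beta>"
      using \<beta> by (simp add: sum_subtractf code_sum_def field_simps)
    also have "\<dots> = ln (exp (\<beta> * ?S) * p) / \<beta>" using p by (simp add: ln_mult)
    also have "\<dots> \<le> ln (measure (code_image \<beta>) U) / \<beta>"
      using pos le \<beta> by (intro divide_right_mono ln_mono) auto
    finally have "y < ereal (ln (measure (code_image \<beta>) U) / \<beta>)"
      using c(1) by (simp add: less_trans[of _ "ereal c"])
    then show ?case using pos le by (simp add: log_ereal_def)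
  qed
qed

end

section \<open>The large deviation principle\<close>

theorem theorem4p11:
  fixes \<phi> :: "'j::metric_space \<Rightarrow> 'x::metric_space \<Rightarrow> 'x"
    and \<nu> :: "'j measure"
    and A :: "'j \<Rightarrow> real"
  assumes "compact (UNIV :: 'x set)"
    and "compact (UNIV :: 'j set)"
    and "uniformly_contractible_ifs \<phi>"
    and "borel_probability \<nu>"
    and "measure_supp \<nu> = UNIV"
    and "\<exists>L. L-lipschitz_on UNIV A"
  shows "(\<forall>s x0. (\<lambda>n. ifs_comp \<phi> s n x0) \<longlonglongrightarrow> coding_map \<phi> s) \<and>
    (\<forall>\<beta>>0. \<exists>!\<rho>. is_gibbs_probability \<nu> \<phi> A \<beta> \<rho>) \<and>
    large_deviation_principle (gibbs_probability \<nu> \<phi> A) (gibbs_rate \<phi> A)"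
proof -
  obtain \<gamma> where "0 < \<gamma>" "\<gamma> < 1"
    "\<And>j1 j2 x1 x2. dist (\<phi> j1 x1) (\<phi> j2 x2) \<le> \<gamma> * (dist j1 j2 + dist x1 x2)"
    using assms(3) unfolding uniformly_contractible_ifs_def by blast
  then interpret gibbs_ifs \<phi> \<gamma> \<nu> A
    using assms by unfold_locales (auto dest: lipschitz_on_continuous_on)
  show ?thesis
    unfolding large_deviation_principle_def gibbs_probability_eq
    using coding_map_limit is_gibbs_code_image gibbs_unique borel_probability_code_image
      gibbs_rate_nonneg lower_semicontinuous_gibbs_rate ldp_upper_bound ldp_lower_bound
    by blast
qed

end
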